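(* Let $(X,T)$ be a minimal flow on a compact Hausdorff space $X$ admitting a $T$-invariant (Borel) probability measure. Then for every $x\in X$ the set $V(x)$ is dense in $RP(x)$. Moreover, if $X$ is metrizable, then $V=RP$ (and hence $V$ equals the equicontinuous structure relation $S_{eq}$).
   Context: $X$ compact Hausdorff, $T$ a topological group acting continuously on $X$; minimal means every orbit is dense. Regionally proximal relation: $(x,y)\in RP$ iff there are nets $\{x_i\},\{y_i\}\subset X$, $\{t_i\}\subset T$ and $z\in X$ with $x_i\to x$, $y_i\to y$, $t_ix_i\to z$, $t_iy_i\to z$. Veech relation: $(x,y)\in V$ iff there are $z\in X$ and a net $\{t_i\}\subset T$ with $t_ix\to z$ and $t_i^{-1}z\to y$. For a relation $R$, $R(x)=\{y:(x,y)\in R\}$. The equicontinuous structure relation $S_{eq}$ is the smallest closed $T$-invariant equivalence relation on $X$ such that the quotient flow $X/S_{eq}$ is equicontinuous. *)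

theory Defs
  imports "HOL-Analysis.Analysis" "HOL-Probability.Probability"
begin

definition is_flow :: "('t::topological_group_add \<Rightarrow> 'x::topological_space \<Rightarrow> 'x) \<Rightarrow> bool" where
  "is_flow act \<longleftrightarrow> (\<forall>x. act 0 x = x) \<and> (\<forall>s t x. act (s + t) x = act s (act t x))
     \<and> continuous_on UNIV (\<lambda>(t, x). act t x)"

definition minimal_flow :: "('t::topological_group_add \<Rightarrow> 'x::topological_space \<Rightarrow> 'x) \<Rightarrow> bool" where
  "minimal_flow act \<longleftrightarrow> (\<forall>x. closure (range (\<lambda>t. act t x)) = UNIV)"

text \<open>Nets are represented by proper filters (a net indexed by a directed set I gives the
image filter of its tail filter; any proper filter is a net indexed by its own members).\<close>

definition RP :: "('t::topological_group_add \<Rightarrow> 'x::topological_space \<Rightarrow> 'x) \<Rightarrow> ('x \<times> 'x) set" where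
  "RP act = {(x, y). \<exists>(F :: ('x \<times> 'x \<times> 't) filter) z. F \<noteq> bot
      \<and> ((\<lambda>(a, b, t). a) \<longlongrightarrow> x) F \<and> ((\<lambda>(a, b, t). b) \<longlongrightarrow> y) F
      \<and> ((\<lambda>(a, b, t). act t a) \<longlongrightarrow> z) F \<and> ((\<lambda>(a, b, t). act t b) \<longlongrightarrow> z) F}"

definition Veech :: "('t::topological_group_add \<Rightarrow> 'x::topological_space \<Rightarrow> 'x) \<Rightarrow> ('x \<times> 'x) set" where
  "Veech act = {(x, y). \<exists>(F :: 't filter) z. F \<noteq> bot
      \<and> ((\<lambda>t. act t x) \<longlongrightarrow> z) F \<and> ((\<lambda>t. act (- t) z) \<longlongrightarrow> y) F}"

text \<open>Equicontinuity of the quotient flow X/R, expressed on X: entourages of the compact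
Hausdorff quotient correspond to open R-saturated subsets of X \<times> X containing R.\<close>
definition R_saturated :: "('x \<times> 'x) set \<Rightarrow> ('x \<times> 'x) set \<Rightarrow> bool" where
  "R_saturated R E \<longleftrightarrow> (\<forall>a b a' b'. (a, b) \<in> E \<and> (a, a') \<in> R \<and> (b, b') \<in> R \<longrightarrow> (a', b') \<in> E)"

definition equicontinuous_quotient ::
  "('t::topological_group_add \<Rightarrow> 'x::topological_space \<Rightarrow> 'x) \<Rightarrow> ('x \<times> 'x) set \<Rightarrow> bool" where
  "equicontinuous_quotient act R \<longleftrightarrow>
     (\<forall>E. open E \<and> R \<subseteq> E \<and> R_saturated R E \<longrightarrow>
        (\<exists>D. open D \<and> R \<subseteq> D \<and> R_saturated R D \<and>
             (\<forall>t a b. (a, b) \<in> D \<longrightarrow> (act t a, act t b) \<in> E)))"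

definition admissible_eq_rel ::
  "('t::topological_group_add \<Rightarrow> 'x::topological_space \<Rightarrow> 'x) \<Rightarrow> ('x \<times> 'x) set \<Rightarrow> bool" where
  "admissible_eq_rel act R \<longleftrightarrow> closed R \<and> equiv UNIV R
     \<and> (\<forall>t a b. (a, b) \<in> R \<longrightarrow> (act t a, act t b) \<in> R) \<and> equicontinuous_quotient act R"

definition S_eq :: "('t::topological_group_add \<Rightarrow> 'x::topological_space \<Rightarrow> 'x) \<Rightarrow> ('x \<times> 'x) set" where
  "S_eq act = \<Inter> {R. admissible_eq_rel act R}"

definition has_invariant_prob :: "('t::topological_group_add \<Rightarrow> 'x::topological_space \<Rightarrow> 'x) \<Rightarrow> bool" where
  "has_invariant_prob act \<longleftrightarrow> (\<exists>M :: 'x measure. prob_space M \<and> sets M = sets borel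
      \<and> (\<forall>t A. A \<in> sets M \<longrightarrow> emeasure M (act t -` A) = emeasure M A))"

end

theory Submission
  imports Defs
begin

text \<open>Let \<open>R\<close> be the set of pairs at distance \<open>0\<close> for every continuous invariant pseudometric. It is
an admissible relation containing \<open>RP\<close>, and \<open>RP\<close> is contained in every admissible relation.

For a closed invariant \<open>W \<subseteq> X \<times> X\<close> with fibers \<open>W_y\<close> over the second factor, the outer content of
\<open>W_y\<close> is an upper semicontinuous invariant function of \<open>y\<close>, hence a constant \<open>c\<close> by minimality, and
\<open>outer (W_a \<union> W_b) - c\<close> is a continuous invariant pseudometric. Since nonempty open sets have positive
measure, \<open>(x, y) \<in> R\<close> and \<open>U \<subseteq> W_x\<close> with \<open>U\<close> open imply \<open>U \<subseteq> W_y\<close>. Applied to the orbit closure of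
\<open>U \<times> {x}\<close>, where \<open>U\<close> is a neighbourhood of \<open>y\<close>, this yields \<open>t\<close> and \<open>a \<in> U\<close> such that \<open>t x\<close> and \<open>t a\<close>
lie in a prescribed open set; a nested sequence of such choices produces points of \<open>V(x)\<close> close
to \<open>y\<close>, and \<open>y\<close> itself if \<open>y\<close> has a countable neighbourhood base.\<close>

section \<open>Compact Hausdorff spaces\<close>

text \<open>The filter form of passing to a convergent subnet: \<open>z\<close> is a cluster point
  of the image filter, and \<open>F\<close> is cut down by the preimages of the neighbourhoods of
  \<open>z\<close>.\<close>

lemma compact_subfilter_tendsto:
  fixes f :: "'a \<Rightarrow> 'x::topological_space"
  assumes "compact (UNIV :: 'x set)" and "F \<noteq> bot"
  obtains z F' where "F' \<le> F" "F' \<noteq> bot" "(f \<longlongrightarrow> z) F'"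
proof -
  have "filtermap f F \<noteq> bot"
    using assms(2) by (simp add: filtermap_bot_iff)
  then obtain z where z: "inf (nhds z) (filtermap f F) \<noteq> bot"
    using assms(1) unfolding compact_filter by auto
  define F' where "F' = inf F (filtercomap f (nhds z))"
  have "F' \<noteq> bot"
  proof
    assume "F' = bot"
    then have "eventually (\<lambda>_. False) (inf F (filtercomap f (nhds z)))"
      by (simp add: F'_def)
    then obtain P Q where "eventually P F" and Q: "eventually Q (filtercomap f (nhds z))"
      and PQ: "\<And>a. P a \<Longrightarrow> Q a \<Longrightarrow> False"
      unfolding eventually_inf by auto
    from Q obtain S where S: "eventually S (nhds z)" "\<And>a. S (f a) \<Longrightarrow> Q a"
      unfolding eventually_filtercomap by auto
    have "eventually (\<lambda>w. \<not> S w) (filtermap f F)"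
      unfolding eventually_filtermap
      using \<open>eventually P F\<close> by (rule eventually_mono) (use PQ S(2) in blast)
    with S(1) have "eventually (\<lambda>_. False) (inf (nhds z) (filtermap f F))"
      unfolding eventually_inf by blast
    with z show False
      by (simp add: trivial_limit_def)
  qed
  moreover have "(f \<longlongrightarrow> z) F'"
    by (auto simp: F'_def filterlim_iff_le_filtercomap)
  ultimately show thesis
    using that[of F' z] by (simp add: F'_def)
qed

lemma compact_UNIV_prod:
  "compact (UNIV :: 'x::topological_space set) \<Longrightarrow> compact (UNIV :: ('x \<times> 'x) set)"
  using compact_Times[of "UNIV :: 'x set" "UNIV :: 'x set"] by simp

lemma closed_image_compact_t2:
  fixes f :: "'a::topological_space \<Rightarrow> 'b::t2_space"
  assumes "compact (UNIV :: 'a set)" "closed S" "continuous_on UNIV f"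
  shows "closed (f ` S)"
proof -
  have "compact S"
    using assms(1,2) compact_Int_closed by fastforce
  then show ?thesis
    using assms(3)
    by (intro compact_imp_closed compact_continuous_image) (auto intro: continuous_on_subset)
qed

lemma compact_t2_normal:
  fixes S T :: "'x::t2_space set"
  assumes "compact (UNIV :: 'x set)" "closed S" "closed T" "S \<inter> T = {}"
  obtains U V where "open U" "open V" "S \<subseteq> U" "T \<subseteq> V" "U \<inter> V = {}"
proof -
  have "Hausdorff_space (euclidean :: 'x topology)"
    unfolding Hausdorff_space_def by (auto simp: disjnt_def) (metis hausdorff)
  moreover have "compact_space (euclidean :: 'x topology)"
    using assms(1) by (simp add: compact_space_def)
  ultimately have "normal_space (euclidean :: 'x topology)"
    by (simp add: compact_Hausdorff_or_regular_imp_normal_space)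
  then have "\<exists>U V. open U \<and> open V \<and> S \<subseteq> U \<and> T \<subseteq> V \<and> disjnt U V"
    using assms(2-4) unfolding normal_space_def by (simp add: disjnt_def)
  then show thesis
    using that by (auto simp: disjnt_def)
qed

lemma compact_t2_shrink:
  fixes U :: "'x::t2_space set"
  assumes "compact (UNIV :: 'x set)" "open U" "p \<in> U"
  obtains V where "open V" "p \<in> V" "closure V \<subseteq> U"
proof -
  obtain A B where AB: "open A" "open B" "{p} \<subseteq> A" "- U \<subseteq> B" "A \<inter> B = {}"
    by (rule compact_t2_normal[OF assms(1), of "{p}" "- U"]) (use assms in auto)
  then have "closure A \<subseteq> - B"
    by (intro closure_minimal) auto
  with AB show thesis
    using that[of A] by auto
qed

lemma metrizable_decreasing_nhds_base:
  fixes y :: "'x::topological_space"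
  assumes "metrizable_space (euclidean :: 'x topology)"
  obtains B :: "nat \<Rightarrow> 'x set"
  where "\<And>n. open (B n)" "\<And>n. y \<in> B n" "decseq B"
    "\<And>U. open U \<Longrightarrow> y \<in> U \<Longrightarrow> \<exists>n. B n \<subseteq> U"
proof -
  obtain X :: "'x set" and d where m: "Metric_space X d" and eq: "euclidean = Metric_space.mtopology X d"
    using assms unfolding metrizable_space_def by auto
  interpret Metric_space X d by (rule m)
  have X: "X = UNIV"
    using eq topspace_mtopology by (metis topspace_euclidean)
  have op: "open U \<longleftrightarrow> openin mtopology U" for U
    using eq by (simp add: open_openin)
  define B where "B n = mball y (inverse (real (Suc n)))" for n
  show thesis
  proof
    show "open (B n)" for n
      unfolding op B_def by simp
    show "y \<in> B n" for n
      using centre_in_mball_iff[of y] by (simp add: B_def X)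
    show "decseq B"
      unfolding B_def decseq_Suc_iff
      by (intro allI mball_subset_concentric) (simp add: field_simps)
    show "\<exists>n. B n \<subseteq> U" if "open U" "y \<in> U" for U
    proof -
      obtain r where r: "r > 0" "mball y r \<subseteq> U"
        using \<open>open U\<close> \<open>y \<in> U\<close> unfolding op openin_mtopology by blast
      obtain n where "inverse (real (Suc n)) < r"
        using reals_Archimedean r(1) by blast
      then have "B n \<subseteq> mball y r"
        unfolding B_def by (intro mball_subset_concentric) simp
      with r show ?thesis by blast
    qed
  qed
qed

section \<open>Flows\<close>

lemma act_continuous:
  assumes "is_flow act"
  shows "continuous_on S (act t)"
proof -
  have "continuous_on UNIV (case_prod act)"
    using assms by (simp add: is_flow_def case_prod_eta)
  then have "continuous_on S (\<lambda>x. case_prod act (t, x))"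
    by (rule continuous_on_compose2) (auto intro!: continuous_intros)
  then show ?thesis by simp
qed

lemma act_minus:
  assumes "is_flow act"
  shows "act (- t) (act t x) = x" "act t (act (- t) x) = x"
proof -
  have add: "act s (act t x) = act (s + t) x" and zero: "act 0 x = x" for s t
    using assms by (simp_all add: is_flow_def)
  show "act (- t) (act t x) = x" "act t (act (- t) x) = x"
    by (simp_all add: add zero)
qed

lemma act_image_eq_vimage:
  assumes "is_flow act"
  shows "act t ` S = act (- t) -` S"
proof (intro equalityI subsetI)
  fix y assume "y \<in> act (- t) -` S"
  then show "y \<in> act t ` S"
    by (intro image_eqI[of _ _ "act (- t) y"]) (simp_all add: act_minus[OF assms])
qed (auto simp: act_minus[OF assms])

lemma open_act_vimage:
  assumes "is_flow act" "open S"
  shows "open (act t -` S)"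
  using open_vimage[OF assms(2) act_continuous[OF assms(1)]] .

lemma minimal_flow_orbit_meets_open:
  assumes "minimal_flow act" "open U" "U \<noteq> {}"
  obtains t where "act t x \<in> U"
proof -
  have "closure (range (\<lambda>t. act t x)) = UNIV"
    using assms(1) by (simp add: minimal_flow_def)
  then have "U \<inter> closure (range (\<lambda>t. act t x)) \<noteq> {}"
    using assms(3) by simp
  then have "U \<inter> range (\<lambda>t. act t x) \<noteq> {}"
    using open_Int_closure_eq_empty[OF assms(2)] by blast
  then show thesis
    using that by auto
qed

text \<open>Pair the constant net \<open>x\<close> with the points \<open>act (- t) z\<close>, which
  \<open>t\<close> carries exactly to \<open>z\<close>.\<close>

lemma Veech_subset_RP:
  assumes "is_flow act"
  shows "Veech act \<subseteq> RP act"
proof clarify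
  fix x y assume "(x, y) \<in> Veech act"
  then obtain F z where F: "F \<noteq> bot" "((\<lambda>t. act t x) \<longlongrightarrow> z) F" "((\<lambda>t. act (- t) z) \<longlongrightarrow> y) F"
    unfolding Veech_def by auto
  define G where "G = filtermap (\<lambda>t. (x, act (- t) z, t)) F"
  have "G \<noteq> bot"
    using F(1) by (simp add: G_def filtermap_bot_iff)
  moreover have "((\<lambda>(a, b, t). a) \<longlongrightarrow> x) G" "((\<lambda>(a, b, t). b) \<longlongrightarrow> y) G"
    "((\<lambda>(a, b, t). act t a) \<longlongrightarrow> z) G" "((\<lambda>(a, b, t). act t b) \<longlongrightarrow> z) G"
    using F by (simp_all add: G_def filterlim_filtermap act_minus[OF assms])
  ultimately show "(x, y) \<in> RP act"
    unfolding RP_def by blast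
qed

section \<open>The regionally proximal relation and equicontinuous quotients\<close>

text \<open>The saturation of \<open>C\<close> is a projection of a closed subset of a compact
  space.\<close>

lemma closed_class_saturation:
  fixes R :: "('x::t2_space \<times> 'x) set"
  assumes "compact (UNIV :: 'x set)" "closed R" "closed C"
  shows "closed {(a, b). \<exists>a' b'. (a', b') \<in> C \<and> (a, a') \<in> R \<and> (b, b') \<in> R}"
proof -
  let ?S = "{p :: ('x \<times> 'x) \<times> ('x \<times> 'x). snd p \<in> C \<and>
      (fst (fst p), fst (snd p)) \<in> R \<and> (snd (fst p), snd (snd p)) \<in> R}"
  have eq: "?S = snd -` C \<inter> (\<lambda>p. (fst (fst p), fst (snd p))) -` R
      \<inter> (\<lambda>p. (snd (fst p), snd (snd p))) -` R"
    by auto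
  have "closed ?S"
    unfolding eq
    by (intro closed_Int closed_vimage assms continuous_intros)
  then have "closed (fst ` ?S)"
    by (rule closed_image_compact_t2[OF compact_UNIV_prod[OF compact_UNIV_prod[OF assms(1)]]])
      (intro continuous_intros)
  also have "fst ` ?S = {(a, b). \<exists>a' b'. (a', b') \<in> C \<and> (a, a') \<in> R \<and> (b, b') \<in> R}"
    by (force simp: image_iff)
  finally show ?thesis .
qed

text \<open>The translated pairs tend to \<open>(z, z)\<close>, so they end up in any neighbourhood
  \<open>D\<close> of \<open>R\<close>. Equicontinuity, applied to the inverse translations, then
  puts the original pairs into a neighbourhood \<open>E\<close> of \<open>R\<close> chosen to miss a
  neighbourhood of \<open>(x, y)\<close>.\<close>

lemma RP_subset_admissible_eq_rel:
  fixes act :: "'t::topological_group_add \<Rightarrow> 'x::t2_space \<Rightarrow> 'x"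
  assumes comp: "compact (UNIV :: 'x set)" and flow: "is_flow act" and adm: "admissible_eq_rel act R"
  shows "RP act \<subseteq> R"
proof clarify
  fix x y assume "(x, y) \<in> RP act"
  then obtain F :: "('x \<times> 'x \<times> 't) filter" and z where F: "F \<noteq> bot"
    and lim: "((\<lambda>(a, b, t). a) \<longlongrightarrow> x) F" "((\<lambda>(a, b, t). b) \<longlongrightarrow> y) F"
      "((\<lambda>(a, b, t). act t a) \<longlongrightarrow> z) F" "((\<lambda>(a, b, t). act t b) \<longlongrightarrow> z) F"
    unfolding RP_def by auto
  have clR: "closed R" and eqR: "equiv UNIV R" and equi: "equicontinuous_quotient act R"
    using adm by (auto simp: admissible_eq_rel_def)
  have refl: "(a, a) \<in> R" for a
    using eqR by (simp add: equiv_def refl_on_def)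
  have sym: "(a, b) \<in> R \<Longrightarrow> (b, a) \<in> R" for a b
    using eqR by (meson equivE symD)
  have trans: "(a, b) \<in> R \<Longrightarrow> (b, c) \<in> R \<Longrightarrow> (a, c) \<in> R" for a b c
    using eqR by (meson equivE transD)
  show "(x, y) \<in> R"
  proof (rule ccontr)
    assume xy: "(x, y) \<notin> R"
    define sat where
      "sat C = {(a, b). \<exists>a' b'. (a', b') \<in> C \<and> (a, a') \<in> R \<and> (b, b') \<in> R}" for C
    have cl_sat: "closed (sat C)" if "closed C" for C
      unfolding sat_def by (rule closed_class_saturation[OF comp clR that])
    have "(a, b) \<notin> R" if "(a, x) \<in> R" "(b, y) \<in> R" for a b
      using xy trans[OF sym[OF that(1)] trans[OF _ that(2)]] by blast
    then have disj: "R \<inter> sat {(x, y)} = {}"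
      unfolding sat_def by blast
    obtain A B where AB: "open A" "open B" "R \<subseteq> A" "sat {(x, y)} \<subseteq> B" "A \<inter> B = {}"
      by (rule compact_t2_normal[OF compact_UNIV_prod[OF comp] clR cl_sat disj]) auto
    \<comment> \<open>Equicontinuity speaks of saturated sets, so \<open>A\<close> is replaced by
      its largest saturated subset; this is open because saturations of closed sets are
      closed.\<close>
    define E where "E = - sat (- A)"
    have "open E"
      unfolding E_def using AB(1) by (intro open_Compl cl_sat) auto
    moreover have "R \<subseteq> E"
    proof clarify
      fix a b assume "(a, b) \<in> R"
      then have "(a', b') \<in> A" if "(a, a') \<in> R" "(b, b') \<in> R" for a' b'
        using AB(3) trans[OF sym[OF that(1)] trans[OF _ that(2)]] by blast
      then show "(a, b) \<in> E"
        unfolding E_def sat_def by blast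
    qed
    moreover have "R_saturated R E"
      unfolding R_saturated_def
    proof (intro allI impI, elim conjE)
      fix a b a' b' assume E: "(a, b) \<in> E" and R: "(a, a') \<in> R" "(b, b') \<in> R"
      have "(c, d) \<in> A" if "(a', c) \<in> R" "(b', d) \<in> R" for c d
        using E trans[OF R(1) that(1)] trans[OF R(2) that(2)] unfolding E_def sat_def by blast
      then show "(a', b') \<in> E"
        unfolding E_def sat_def by blast
    qed
    ultimately obtain D where D: "open D" "R \<subseteq> D"
      "\<And>t a b. (a, b) \<in> D \<Longrightarrow> (act t a, act t b) \<in> E"
      using equi unfolding equicontinuous_quotient_def by metis
    have "((\<lambda>p. (case p of (a, b, t) \<Rightarrow> act t a, case p of (a, b, t) \<Rightarrow> act t b)) \<longlongrightarrow> (z, z)) F"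
      using lim by (intro tendsto_Pair)
    moreover have "(z, z) \<in> D"
      using D(2) refl by blast
    ultimately have 1: "\<forall>\<^sub>F p in F. (case p of (a, b, t) \<Rightarrow> act t a, case p of (a, b, t) \<Rightarrow> act t b) \<in> D"
      using D(1) topological_tendstoD by blast
    have "((\<lambda>p. (case p of (a, b, t) \<Rightarrow> a, case p of (a, b, t) \<Rightarrow> b)) \<longlongrightarrow> (x, y)) F"
      using lim by (intro tendsto_Pair)
    moreover have "(x, y) \<in> B"
      using AB(4) refl unfolding sat_def by blast
    ultimately have 2: "\<forall>\<^sub>F p in F. (case p of (a, b, t) \<Rightarrow> a, case p of (a, b, t) \<Rightarrow> b) \<in> B"
      using AB(2) topological_tendstoD by blast
    obtain p where p: "(case p of (a, b, t) \<Rightarrow> act t a, case p of (a, b, t) \<Rightarrow> act t b) \<in> D"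
      "(case p of (a, b, t) \<Rightarrow> a, case p of (a, b, t) \<Rightarrow> b) \<in> B"
      using eventually_happens'[OF F eventually_conj[OF 1 2]] by blast
    obtain a b t where "p = (a, b, t)"
      by (cases p)
    with p have "(act t a, act t b) \<in> D" and B: "(a, b) \<in> B"
      by auto
    then have "(act (- t) (act t a), act (- t) (act t b)) \<in> E"
      using D(3) by blast
    then have "(a, b) \<in> E"
      by (simp add: act_minus[OF flow])
    moreover have "E \<subseteq> A"
      using refl unfolding E_def sat_def by blast
    ultimately show False
      using AB(5) B by blast
  qed
qed

section \<open>Continuous invariant pseudometrics\<close>

definition invariant_pseudometric ::
  "('t \<Rightarrow> 'x::t2_space \<Rightarrow> 'x) \<Rightarrow> ('x \<Rightarrow> 'x \<Rightarrow> real) \<Rightarrow> bool" where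
  "invariant_pseudometric act e \<longleftrightarrow> (\<forall>a. e a a = 0) \<and> (\<forall>a b. e a b = e b a)
     \<and> (\<forall>a b c. e a c \<le> e a b + e b c) \<and> (\<forall>t a b. e (act t a) (act t b) = e a b)
     \<and> continuous_on UNIV (\<lambda>(a, b). e a b)"

definition pseudometric_rel ::
  "('t \<Rightarrow> 'x::t2_space \<Rightarrow> 'x) \<Rightarrow> ('x \<times> 'x) set" where
  "pseudometric_rel act = {(a, b). \<forall>e. invariant_pseudometric act e \<longrightarrow> e a b = 0}"

context
  fixes act :: "'t \<Rightarrow> 'x::t2_space \<Rightarrow> 'x" and e
  assumes e: "invariant_pseudometric act e"
begin

lemma pseudometric_self: "e a a = 0"
  and pseudometric_sym: "e a b = e b a"
  and pseudometric_triangle: "e a c \<le> e a b + e b c"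
  and pseudometric_invariant: "e (act t a) (act t b) = e a b"
  and pseudometric_continuous: "continuous_on UNIV (\<lambda>(a, b). e a b)"
  using e unfolding invariant_pseudometric_def by (elim conjE, simp)+

lemma pseudometric_nonneg: "0 \<le> e a b"
  using pseudometric_triangle[of a a b] pseudometric_sym[of a b] pseudometric_self[of a] by simp

lemma pseudometric_tendsto:
  assumes "(f \<longlongrightarrow> a) F" "(g \<longlongrightarrow> b) F"
  shows "((\<lambda>p. e (f p) (g p)) \<longlongrightarrow> e a b) F"
proof -
  have "isCont (\<lambda>(a, b). e a b) (a, b)"
    using pseudometric_continuous by (simp add: continuous_on_eq_continuous_at)
  from isCont_tendsto_compose[OF this tendsto_Pair[OF assms]] show ?thesis
    by simp
qed

end

text \<open>Upper semicontinuity suffices for continuity: a pseudometric vanishes on the diagonal, so it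
is small near it, and the triangle inequality spreads this to all of \<open>X \<times> X\<close>.\<close>

lemma pseudometric_continuousI:
  fixes e :: "'x::t2_space \<Rightarrow> 'x \<Rightarrow> real"
  assumes self: "\<And>a. e a a = 0" and sym: "\<And>a b. e a b = e b a"
    and tri: "\<And>a b c. e a c \<le> e a b + e b c"
    and usc: "\<And>r. open {(a, b). e a b < r}"
  shows "continuous_on UNIV (\<lambda>(a, b). e a b)"
proof -
  have "isCont (\<lambda>(a, b). e a b) (a, b)" for a b
    unfolding isCont_def
  proof (rule tendstoI)
    fix r :: real assume r: "r > 0"
    have op: "open {c. e p c < r / 2}" for p
    proof -
      have "open ((\<lambda>c. (p, c)) -` {(a, b). e a b < r / 2})"
        by (intro open_vimage usc continuous_intros)
      then show ?thesis by (simp add: vimage_def)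
    qed
    have "open ({c. e a c < r / 2} \<times> {c. e b c < r / 2})"
      using op by (intro open_Times)
    moreover have "(a, b) \<in> {c. e a c < r / 2} \<times> {c. e b c < r / 2}"
      using r self by simp
    ultimately have "\<forall>\<^sub>F p in at (a, b). p \<in> {c. e a c < r / 2} \<times> {c. e b c < r / 2}"
      unfolding eventually_at_topological by blast
    then show "\<forall>\<^sub>F p in at (a, b). dist (case p of (a, b) \<Rightarrow> e a b) (case (a, b) of (a, b) \<Rightarrow> e a b) < r"
    proof (rule eventually_mono)
      fix p assume p: "p \<in> {c. e a c < r / 2} \<times> {c. e b c < r / 2}"
      obtain c d where cd: "p = (c, d)"
        by (cases p)
      have "e c d \<le> e c a + e a b + e b d" "e a b \<le> e a c + e c d + e d b"
        using tri[of c d a] tri[of a d b] tri[of a b c] tri[of c b d] by linarith+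
      then show "dist (case p of (a, b) \<Rightarrow> e a b) (case (a, b) of (a, b) \<Rightarrow> e a b) < r"
        using p sym[of a c] sym[of b d] by (auto simp: cd dist_real_def)
    qed
  qed
  then show ?thesis
    by (intro continuous_at_imp_continuous_on) auto
qed

text \<open>An invariant \<open>e\<close> takes the same values along the pairs and along their
  translates; the two limits are \<open>e x y\<close> and \<open>e z z = 0\<close>.\<close>

lemma RP_subset_pseudometric_rel:
  fixes act :: "'t::topological_group_add \<Rightarrow> 'x::t2_space \<Rightarrow> 'x"
  shows "RP act \<subseteq> pseudometric_rel act"
proof clarify
  fix x y assume "(x, y) \<in> RP act"
  then obtain F :: "('x \<times> 'x \<times> 't) filter" and z where F: "F \<noteq> bot"
    and lim: "((\<lambda>(a, b, t). a) \<longlongrightarrow> x) F" "((\<lambda>(a, b, t). b) \<longlongrightarrow> y) F"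
      "((\<lambda>(a, b, t). act t a) \<longlongrightarrow> z) F" "((\<lambda>(a, b, t). act t b) \<longlongrightarrow> z) F"
    unfolding RP_def by auto
  have "e x y = 0" if e: "invariant_pseudometric act e" for e
  proof -
    have "((\<lambda>p. e (case p of (a, b, t) \<Rightarrow> act t a) (case p of (a, b, t) \<Rightarrow> act t b)) \<longlongrightarrow> e z z) F"
      using pseudometric_tendsto[OF e] lim(3,4) by blast
    moreover have "e (case p of (a, b, t) \<Rightarrow> act t a) (case p of (a, b, t) \<Rightarrow> act t b)
        = e (case p of (a, b, t) \<Rightarrow> a) (case p of (a, b, t) \<Rightarrow> b)" for p
      by (cases p) (simp add: pseudometric_invariant[OF e])
    ultimately have "((\<lambda>p. e (case p of (a, b, t) \<Rightarrow> a) (case p of (a, b, t) \<Rightarrow> b)) \<longlongrightarrow> 0) F"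
      by (simp add: pseudometric_self[OF e])
    with pseudometric_tendsto[OF e lim(1,2)] show ?thesis
      using tendsto_unique[OF F] by blast
  qed
  then show "(x, y) \<in> pseudometric_rel act"
    by (simp add: pseudometric_rel_def)
qed

text \<open>For equicontinuity, compactness of \<open>- E\<close> yields finitely many pseudometrics
  and radii that cut out a set \<open>D\<close> inside \<open>E\<close>. The conditions
  \<open>e a b < r\<close> are saturated and invariant, so all translates of pairs in
  \<open>D\<close> remain in \<open>E\<close>.\<close>

lemma admissible_pseudometric_rel:
  fixes act :: "'t::topological_group_add \<Rightarrow> 'x::t2_space \<Rightarrow> 'x"
  assumes comp: "compact (UNIV :: 'x set)"
  shows "admissible_eq_rel act (pseudometric_rel act)"
  unfolding admissible_eq_rel_def
proof (intro conjI allI impI)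
  let ?R = "pseudometric_rel act"
  let ?P = "Collect (invariant_pseudometric act)"
  have "?R = (\<Inter>e\<in>?P. {p. (\<lambda>(a, b). e a b) p = 0})"
    by (auto simp: pseudometric_rel_def)
  moreover have "closed {p. (\<lambda>(a, b). e a b) p = 0}" if "e \<in> ?P" for e
    using that pseudometric_continuous[of act e]
    by (intro closed_Collect_eq) (auto intro: continuous_intros)
  ultimately show "closed ?R"
    by (simp add: closed_INT)
  show "equiv UNIV ?R"
  proof (rule equivI)
    show "?R \<subseteq> UNIV \<times> UNIV" by simp
    show "refl ?R"
      by (auto simp: refl_on_def pseudometric_rel_def pseudometric_self)
    show "sym ?R"
      using pseudometric_sym[of act] by (auto simp: sym_def pseudometric_rel_def)
    show "trans ?R"
    proof (rule transI)
      fix a b c assume ab: "(a, b) \<in> ?R" and bc: "(b, c) \<in> ?R"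
      have "e a c = 0" if "invariant_pseudometric act e" for e
      proof -
        have "e a b = 0" "e b c = 0"
          using ab bc that by (auto simp: pseudometric_rel_def)
        then show ?thesis
          using pseudometric_triangle[OF that, of a c b] pseudometric_nonneg[OF that, of a c]
          by linarith
      qed
      then show "(a, c) \<in> ?R"
        by (simp add: pseudometric_rel_def)
    qed
  qed
  show "(act t a, act t b) \<in> ?R" if "(a, b) \<in> ?R" for t a b
    using that by (auto simp: pseudometric_rel_def pseudometric_invariant)
  show "equicontinuous_quotient act ?R"
    unfolding equicontinuous_quotient_def
  proof (intro allI impI, elim conjE)
    fix E assume E: "open E" "?R \<subseteq> E"
    define I where "I = {(e, r). invariant_pseudometric act e \<and> (r::real) > 0}"
    define G :: "('x \<Rightarrow> 'x \<Rightarrow> real) \<times> real \<Rightarrow> ('x \<times> 'x) set"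
      where "G = (\<lambda>(e, r). {(a, b). r < e a b})"
    have "compact (- E)"
      using compact_Int_closed[OF compact_UNIV_prod[OF comp], of "- E"] E(1) by (simp add: closed_Compl)
    moreover have "open (G i)" if iI: "i \<in> I" for i
    proof -
      obtain e r where i: "i = (e, r)" "invariant_pseudometric act e"
        using iI by (cases i) (simp add: I_def)
      have "open {p. r < (\<lambda>(a, b). e a b) p}"
        using pseudometric_continuous[OF i(2)]
        by (intro open_Collect_less) (auto intro: continuous_intros)
      then show ?thesis
        by (simp add: G_def i(1) case_prod_unfold)
    qed
    moreover have "- E \<subseteq> (\<Union>i\<in>I. G i)"
    proof
      fix p assume "p \<in> - E"
      then obtain a b e where p: "p = (a, b)" and e: "invariant_pseudometric act e" "e a b \<noteq> 0"
        using E(2) by (cases p) (force simp: pseudometric_rel_def)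
      then have "(e, e a b / 2) \<in> I" "p \<in> G (e, e a b / 2)"
        using pseudometric_nonneg[OF e(1), of a b] by (auto simp: I_def G_def)
      then show "p \<in> (\<Union>i\<in>I. G i)"
        by blast
    qed
    ultimately obtain J where J: "J \<subseteq> I" "finite J" "- E \<subseteq> (\<Union>i\<in>J. G i)"
      by (rule compactE_image)
    define D where "D = (\<Inter>(e, r)\<in>J. {(a, b). e a b < r})"
    have "open D"
      unfolding D_def
    proof (rule open_INT[OF J(2)], clarify)
      fix e r assume "(e, r) \<in> J"
      then have e: "invariant_pseudometric act e"
        using J(1) by (auto simp: I_def)
      have "open {p. (\<lambda>(a, b). e a b) p < r}"
        using pseudometric_continuous[OF e]
        by (intro open_Collect_less) (auto intro: continuous_intros)
      then show "open {(a, b). e a b < r}"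
        by (simp add: case_prod_unfold)
    qed
    moreover have "?R \<subseteq> D"
      using J(1) by (fastforce simp: D_def I_def pseudometric_rel_def)
    moreover have "R_saturated ?R D"
      unfolding R_saturated_def
    proof (intro allI impI, elim conjE)
      fix a b a' b' assume D: "(a, b) \<in> D" and R: "(a, a') \<in> ?R" "(b, b') \<in> ?R"
      have "e a' b' < r" if "(e, r) \<in> J" for e r
      proof -
        have e: "invariant_pseudometric act e"
          using that J(1) by (auto simp: I_def)
        have "e a a' = 0" "e b b' = 0"
          using R e by (auto simp: pseudometric_rel_def)
        moreover have "e a b < r"
          using D that by (auto simp: D_def)
        ultimately show ?thesis
          using pseudometric_triangle[OF e, of a' b' a] pseudometric_triangle[OF e, of a b' b]
            pseudometric_sym[OF e, of a a'] by linarith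
      qed
      then show "(a', b') \<in> D"
        by (auto simp: D_def)
    qed
    moreover have "(act t a, act t b) \<in> E" if D: "(a, b) \<in> D" for t a b
    proof (rule ccontr)
      assume "(act t a, act t b) \<notin> E"
      then obtain e r where er: "(e, r) \<in> J" "r < e (act t a) (act t b)"
        using J(3) by (force simp: G_def)
      then have e: "invariant_pseudometric act e"
        using J(1) by (auto simp: I_def)
      have "e a b < r"
        using D er(1) by (auto simp: D_def)
      then show False
        using er(2) by (simp add: pseudometric_invariant[OF e])
    qed
    ultimately show "\<exists>D. open D \<and> ?R \<subseteq> D \<and> R_saturated ?R D \<and>
        (\<forall>t a b. (a, b) \<in> D \<longrightarrow> (act t a, act t b) \<in> E)"
      by blast
  qed
qed

section \<open>Minimal flows with an invariant probability measure\<close>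

locale measured_minimal_flow = prob_space M
  for M :: "'x::t2_space measure" +
  fixes act :: "'t::topological_group_add \<Rightarrow> 'x \<Rightarrow> 'x"
  assumes compact_UNIV: "compact (UNIV :: 'x set)"
    and flow: "is_flow act"
    and minimal: "minimal_flow act"
    and sets_M: "sets M = sets borel"
    and emeasure_act: "A \<in> sets M \<Longrightarrow> emeasure M (act t -` A) = emeasure M A"
begin

lemma measurable_open: "open U \<Longrightarrow> U \<in> sets M"
  by (simp add: sets_M)

lemma space_UNIV: "space M = UNIV"
  using sets_eq_imp_space_eq[OF sets_M] by simp

lemma prob_act_vimage: "open U \<Longrightarrow> prob (act t -` U) = prob U"
  using emeasure_act[OF measurable_open] by (simp add: measure_def)

text \<open>By minimality and compactness finitely many preimages of \<open>U\<close> cover the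
  space, and all have the same probability as \<open>U\<close>.\<close>

lemma prob_open_pos:
  assumes "open U" "U \<noteq> {}"
  shows "0 < prob U"
proof (rule ccontr)
  assume "\<not> 0 < prob U"
  then have zero: "prob U = 0"
    using measure_nonneg[of M U] by linarith
  have "UNIV \<subseteq> (\<Union>t\<in>UNIV. act t -` U)"
    using minimal_flow_orbit_meets_open[OF minimal assms] by blast
  then obtain C where C: "finite C" "UNIV \<subseteq> (\<Union>t\<in>C. act t -` U)"
    using compactE_image[OF compact_UNIV, of UNIV "\<lambda>t. act t -` U"]
      open_act_vimage[OF flow assms(1)] by metis
  have "1 = prob (\<Union>t\<in>C. act t -` U)"
    using C(2) prob_space space_UNIV by (metis top.extremum_uniqueI)
  also have "\<dots> \<le> (\<Sum>t\<in>C. prob (act t -` U))"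
    using C(1) open_act_vimage[OF flow assms(1)]
    by (intro finite_measure_subadditive_finite) (auto intro: measurable_open)
  also have "\<dots> = 0"
    using prob_act_vimage[OF assms(1)] zero by simp
  finally show False by simp
qed

text \<open>\<open>M\<close> need not be regular, so it is replaced by its outer content on closed sets. This makes
semicontinuity in the set automatic, and submodularity is the only form of additivity needed.\<close>

definition outer :: "'x set \<Rightarrow> real" where
  "outer K = Inf {prob G | G. open G \<and> K \<subseteq> G}"

lemma outer_le: "open G \<Longrightarrow> K \<subseteq> G \<Longrightarrow> outer K \<le> prob G"
  unfolding outer_def by (rule cInf_lower) (auto intro!: bdd_belowI[of _ 0])

lemma outer_greatest: "(\<And>G. open G \<Longrightarrow> K \<subseteq> G \<Longrightarrow> r \<le> prob G) \<Longrightarrow> r \<le> outer K"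
  unfolding outer_def by (rule cInf_greatest) auto

lemma outer_lessE:
  assumes "outer K < r"
  obtains G where "open G" "K \<subseteq> G" "prob G < r"
proof (rule ccontr)
  assume "\<not> thesis"
  then have "r \<le> outer K"
    using that by (intro outer_greatest leI) blast
  with assms show False
    by simp
qed

lemma outer_mono: "K \<subseteq> L \<Longrightarrow> outer K \<le> outer L"
  by (rule outer_greatest) (auto intro: outer_le)

text \<open>Inherited from additivity on open sets: take nearly optimal open \<open>G\<close> and
  \<open>H\<close> around \<open>K\<close> and \<open>L\<close>, whose union and intersection
  compete for \<open>K \<union> L\<close> and \<open>K \<inter> L\<close>.\<close>

lemma outer_submodular: "outer (K \<union> L) + outer (K \<inter> L) \<le> outer K + outer L"
proof (rule field_le_epsilon)
  fix r :: real assume "r > 0"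
  obtain G where G: "open G" "K \<subseteq> G" "prob G < outer K + r / 2"
    by (rule outer_lessE[of K "outer K + r / 2"]) (use \<open>r > 0\<close> in auto)
  obtain H where H: "open H" "L \<subseteq> H" "prob H < outer L + r / 2"
    by (rule outer_lessE[of L "outer L + r / 2"]) (use \<open>r > 0\<close> in auto)
  have "outer (K \<union> L) \<le> prob (G \<union> H)" "outer (K \<inter> L) \<le> prob (G \<inter> H)"
    using G H by (auto intro!: outer_le)
  moreover have "prob (G \<union> H) = prob G + prob H - prob (G \<inter> H)"
    using G(1) H(1) by (intro measure_Un3) (auto simp: fmeasurable_eq_sets measurable_open)
  ultimately show "outer (K \<union> L) + outer (K \<inter> L) \<le> outer K + outer L + r"
    using G(3) H(3) by linarith
qed

lemma outer_act_image: "outer (act t ` K) = outer K"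
proof -
  have le: "outer (act t ` K) \<le> outer K" for t K
  proof (rule outer_greatest)
    fix G assume G: "open G" "K \<subseteq> G"
    have "outer (act t ` K) \<le> prob (act t ` G)"
      using G open_act_vimage[OF flow G(1)]
      by (intro outer_le) (auto simp: act_image_eq_vimage[OF flow])
    then show "outer (act t ` K) \<le> prob G"
      using G(1) by (simp add: act_image_eq_vimage[OF flow] prob_act_vimage)
  qed
  have "act (- t) ` act t ` K = K"
    by (simp add: image_image act_minus[OF flow])
  with le[of t K] le[of "- t" "act t ` K"] show ?thesis
    by simp
qed

text \<open>The set \<open>U - K\<close> contains an open set whose closure misses \<open>K\<close>, so it would add positive
content to \<open>K\<close>.\<close>

lemma open_subset_of_outer_eq:
  assumes "closed K" "open U" "outer (K \<union> U) \<le> outer K"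
  shows "U \<subseteq> K"
proof (rule ccontr)
  assume "\<not> U \<subseteq> K"
  then obtain p where p: "p \<in> U - K" by blast
  obtain V where V: "open V" "p \<in> V" "closure V \<subseteq> U - K"
    using compact_t2_shrink[OF compact_UNIV _ p] assms(1,2) by blast
  \<comment> \<open>Any open \<open>G\<close> around \<open>K \<union> U\<close> contains the
    disjoint open sets \<open>V\<close> and \<open>G - closure V\<close>, and the latter still
    contains \<open>K\<close>.\<close>
  have "outer K + prob V \<le> outer (K \<union> U)"
  proof (rule outer_greatest)
    fix G assume G: "open G" "K \<union> U \<subseteq> G"
    have "outer K \<le> prob (G - closure V)"
      using G V(3) by (intro outer_le) auto
    moreover have "prob (G - closure V) + prob V = prob ((G - closure V) \<union> V)"
      using G V closure_subset[of V]
      by (intro finite_measure_Union[symmetric] measurable_open) auto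
    moreover have "\<dots> \<le> prob G"
      using G V closure_subset[of V] by (intro finite_measure_mono) (auto simp: measurable_open)
    ultimately show "outer K + prob V \<le> prob G"
      by linarith
  qed
  moreover have "0 < prob V"
    using V by (intro prob_open_pos) auto
  ultimately show False
    using assms(3) by linarith
qed

definition fiber :: "('x \<times> 'x) set \<Rightarrow> 'x \<Rightarrow> 'x set" where
  "fiber W y = {a. (a, y) \<in> W}"

text \<open>For a measure and fibers of equal mass this is half the mass of the symmetric
  difference. It is written with unions because these vary semicontinuously with \<open>a\<close>
  and \<open>b\<close>.\<close>

definition fiber_dist :: "('x \<times> 'x) set \<Rightarrow> 'x \<Rightarrow> 'x \<Rightarrow> real" where
  "fiber_dist W a b = outer (fiber W a \<union> fiber W b) - outer (fiber W a)"

context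
  fixes W :: "('x \<times> 'x) set"
  assumes closed_W: "closed W" and invariant_W: "\<forall>t a b. (a, b) \<in> W \<longrightarrow> (act t a, act t b) \<in> W"
begin

lemma closed_fiber: "closed (fiber W y)"
proof -
  have "closed ((\<lambda>a. (a, y)) -` W)"
    by (intro closed_vimage closed_W continuous_intros)
  then show ?thesis
    by (simp add: fiber_def vimage_def)
qed

lemma fiber_act: "fiber W (act t y) = act t ` fiber W y"
proof -
  have "(a, act t y) \<in> W \<longleftrightarrow> (act (- t) a, y) \<in> W" for a
    using invariant_W by (metis act_minus[OF flow])
  then show ?thesis
    by (auto simp: fiber_def act_image_eq_vimage[OF flow])
qed

text \<open>The points whose fiber leaves \<open>G\<close> form the projection of a closed subset of
  a compact space.\<close>

lemma open_fiber_subset: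
  assumes "open G"
  shows "open {y. fiber W y \<subseteq> G}"
proof -
  have "closed (W \<inter> (- G) \<times> UNIV)"
    using assms closed_W by (intro closed_Int closed_Times) auto
  then have "closed (snd ` (W \<inter> (- G) \<times> UNIV))"
    by (rule closed_image_compact_t2[OF compact_UNIV_prod[OF compact_UNIV]])
      (intro continuous_intros)
  then have "open (- snd ` (W \<inter> (- G) \<times> UNIV))"
    by (rule open_Compl)
  also have "- snd ` (W \<inter> (- G) \<times> UNIV) = {y. fiber W y \<subseteq> G}"
    by (force simp: fiber_def image_iff)
  finally show ?thesis .
qed

text \<open>The content is below \<open>r\<close> exactly when both fibers fit into one open
  \<open>G\<close> with \<open>prob G < r\<close>, so the set is a union of open boxes.\<close>

lemma outer_fiber_union_usc: "open {(a, b). outer (fiber W a \<union> fiber W b) < r}"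
proof -
  have "{(a, b). outer (fiber W a \<union> fiber W b) < r} =
      (\<Union>G\<in>{G. open G \<and> prob G < r}. {a. fiber W a \<subseteq> G} \<times> {b. fiber W b \<subseteq> G})"
    by (auto elim!: outer_lessE dest: outer_le intro: order.strict_trans1)
      (meson Un_least order.strict_trans1 outer_le)
  also have "open \<dots>"
    by (intro open_UN ballI open_Times) (auto intro: open_fiber_subset)
  finally show ?thesis .
qed

text \<open>If the content at \<open>a\<close> were below that at \<open>b\<close>, the orbit of
  \<open>b\<close> would enter the open set of points with smaller content, although the content is
  constant along orbits.\<close>

lemma outer_fiber_const: "outer (fiber W a) = outer (fiber W b)"
proof -
  have "outer (fiber W b) \<le> outer (fiber W a)" for a b
  proof (rule ccontr)
    assume "\<not> outer (fiber W b) \<le> outer (fiber W a)"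
    then have lt: "outer (fiber W a) < outer (fiber W b)"
      by simp
    \<comment> \<open>Restriction to the diagonal turns semicontinuity for unions of two fibers into
      semicontinuity for one.\<close>
    have "open ((\<lambda>c. (c, c)) -` {(c, d). outer (fiber W c \<union> fiber W d) < outer (fiber W b)})"
      by (intro open_vimage outer_fiber_union_usc continuous_intros)
    then have "open {c. outer (fiber W c) < outer (fiber W b)}"
      by (simp add: vimage_def)
    then obtain t where "outer (fiber W (act t b)) < outer (fiber W b)"
      using minimal_flow_orbit_meets_open[OF minimal, of "{c. outer (fiber W c) < outer (fiber W b)}" b] lt
      by auto
    then show False
      by (simp add: fiber_act outer_act_image)
  qed
  then show ?thesis
    by (simp add: order.antisym)
qed

text \<open>The constancy of the fiber content gives symmetry and semicontinuity; submodularity for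
  two unions sharing \<open>fiber W b\<close> gives the triangle inequality.\<close>

lemma invariant_pseudometric_fiber_dist: "invariant_pseudometric act (fiber_dist W)"
proof -
  have self: "fiber_dist W a a = 0" for a
    by (simp add: fiber_dist_def)
  have sym: "fiber_dist W a b = fiber_dist W b a" for a b
    using outer_fiber_const[of a b] by (simp add: fiber_dist_def Un_commute)
  have tri: "fiber_dist W a c \<le> fiber_dist W a b + fiber_dist W b c" for a b c
  proof -
    let ?K = "fiber W a \<union> fiber W b" and ?L = "fiber W b \<union> fiber W c"
    have "outer (fiber W a \<union> fiber W c) \<le> outer (?K \<union> ?L)" "outer (fiber W b) \<le> outer (?K \<inter> ?L)"
      by (auto intro!: outer_mono)
    with outer_submodular[of ?K ?L] show ?thesis
      by (simp add: fiber_dist_def)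
  qed
  have inv: "fiber_dist W (act t a) (act t b) = fiber_dist W a b" for t a b
    by (simp add: fiber_dist_def fiber_act outer_act_image flip: image_Un)
  obtain c where const: "outer (fiber W a) = c" for a
    using outer_fiber_const by blast
  have usc: "open {(a, b). fiber_dist W a b < r}" for r
  proof -
    have "{(a, b). fiber_dist W a b < r} =
        {(a, b). outer (fiber W a \<union> fiber W b) < r + c}"
      unfolding fiber_dist_def const by (auto simp: algebra_simps)
    then show ?thesis
      using outer_fiber_union_usc by simp
  qed
  show ?thesis
    unfolding invariant_pseudometric_def
    using self sym tri inv pseudometric_continuousI[OF self sym tri usc] by blast
qed

text \<open>Since \<open>fiber_dist W x y = 0\<close>, adding \<open>fiber W x\<close>, and hence
  \<open>U\<close>, to \<open>fiber W y\<close> does not increase its content.\<close>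

lemma pseudometric_rel_open_subset_fiber:
  assumes "(x, y) \<in> pseudometric_rel act" "open U" "U \<subseteq> fiber W x"
  shows "U \<subseteq> fiber W y"
proof (rule open_subset_of_outer_eq[OF closed_fiber assms(2)])
  have "fiber_dist W x y = 0"
    using assms(1) invariant_pseudometric_fiber_dist by (auto simp: pseudometric_rel_def)
  then have "outer (fiber W x \<union> fiber W y) = outer (fiber W y)"
    using outer_fiber_const[of x y] by (simp add: fiber_dist_def)
  moreover have "outer (fiber W y \<union> U) \<le> outer (fiber W x \<union> fiber W y)"
    using assms(3) by (intro outer_mono) auto
  ultimately show "outer (fiber W y \<union> U) \<le> outer (fiber W y)"
    by simp
qed

end

text \<open>Take \<open>W\<close> to be the closure of the union of the translates of \<open>U \<times> {x}\<close>: its fiber over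
\<open>x\<close> contains \<open>U\<close>, hence so does the one over \<open>y\<close>, and \<open>(y, y) \<in> W\<close>.\<close>

lemma pseudometric_rel_common_visit:
  assumes xy: "(x, y) \<in> pseudometric_rel act"
    and U: "open U" "y \<in> U" and N: "open N" "N \<noteq> {}"
  obtains t a where "a \<in> U" "act t x \<in> N" "act t a \<in> N"
proof -
  have act_add: "act (s + t) c = act s (act t c)" and act_0: "act 0 c = c" for s t c
    using flow by (auto simp: is_flow_def)
  define W0 where "W0 = {(act t a, act t x) | t a. a \<in> U}"
  define W where "W = closure W0"
  have cl: "closed W"
    by (simp add: W_def)
  have inv: "\<forall>t a b. (a, b) \<in> W \<longrightarrow> (act t a, act t b) \<in> W"
  proof (intro allI impI)
    fix t a b assume ab: "(a, b) \<in> W"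
    let ?f = "\<lambda>p. (act t (fst p), act t (snd p))"
    have cont: "continuous_on UNIV ?f"
      by (intro continuous_on_Pair continuous_on_compose2[OF act_continuous[OF flow, of UNIV]]
          continuous_intros) auto
    have "?f ` W0 \<subseteq> W0"
    proof clarify
      fix a b assume "(a, b) \<in> W0"
      then obtain s c where "c \<in> U" "a = act s c" "b = act s x"
        by (auto simp: W0_def)
      then show "(act t (fst (a, b)), act t (snd (a, b))) \<in> W0"
        unfolding W0_def by (auto simp flip: act_add)
    qed
    then have "?f ` W \<subseteq> W"
      unfolding W_def
      using image_closure_subset[OF continuous_on_subset[OF cont], of W0 "closure W0"]
        closure_subset[of W0] by auto
    with ab show "(act t a, act t b) \<in> W"
      by force
  qed
  have "(a, x) \<in> W0" if "a \<in> U" for a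
    unfolding W0_def using that act_0[of a] act_0[of x] by (intro CollectI exI[of _ 0] exI[of _ a]) simp
  then have "U \<subseteq> fiber W x"
    using closure_subset[of W0] unfolding fiber_def W_def by blast
  then have "(y, y) \<in> W"
    using pseudometric_rel_open_subset_fiber[OF cl inv xy U(1)] U(2)
    unfolding fiber_def by auto
  \<comment> \<open>The closure argument finds translates of \<open>x\<close> and \<open>a\<close>
    near \<open>y\<close> only; a further translation by \<open>s\<close> carries that neighbourhood
    of \<open>y\<close> into \<open>N\<close>.\<close>
  moreover obtain s where s: "act s y \<in> N"
    using minimal_flow_orbit_meets_open[OF minimal N] .
  let ?N = "act s -` N"
  have "open (?N \<times> ?N)" "(y, y) \<in> ?N \<times> ?N"
    using s open_act_vimage[OF flow N(1)] by (auto intro: open_Times)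
  ultimately have "(?N \<times> ?N) \<inter> W0 \<noteq> {}"
    unfolding W_def using open_Int_closure_eq_empty[of "?N \<times> ?N" W0] by blast
  then obtain t a where "a \<in> U" "act s (act t a) \<in> N" "act s (act t x) \<in> N"
    by (auto simp: W0_def)
  then show thesis
    using that[of a "s + t"] by (simp add: act_add)
qed

text \<open>Build nonempty open sets \<open>Z n\<close> with \<open>closure (Z (Suc n)) \<subseteq> Z n\<close> and elements \<open>t n\<close> moving \<open>x\<close>
into \<open>Z n\<close> such that \<open>Z (Suc n)\<close> lies in the translate of \<open>B n\<close> by \<open>t n\<close>.
Any cluster point \<open>z\<close> of \<open>t n x\<close> lies in all \<open>Z n\<close>, so no shrinking of the \<open>Z n\<close> to a point is
needed.\<close>

lemma pseudometric_rel_return_filter: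
  fixes B :: "nat \<Rightarrow> 'x set"
  assumes xy: "(x, y) \<in> pseudometric_rel act"
    and B: "\<And>n. open (B n)" "\<And>n. y \<in> B n" "decseq B"
  obtains F z where "F \<noteq> bot" "((\<lambda>t. act t x) \<longlongrightarrow> z) F"
    "\<And>n. \<forall>\<^sub>F t in F. act (- t) z \<in> B n"
proof -
  define Q where "Q n Z Z' t \<longleftrightarrow> act t x \<in> Z \<and> closure Z' \<subseteq> Z \<inter> act (- t) -` B n"
    for n :: nat and Z Z' t
  have step: "\<exists>Z'. (open Z' \<and> Z' \<noteq> {}) \<and> (\<exists>t. Q n Z Z' t)" if Z: "open Z" "Z \<noteq> {}" for n Z
  proof -
    obtain t a where t: "a \<in> B n" "act t x \<in> Z" "act t a \<in> Z"
      using pseudometric_rel_common_visit[OF xy B(1) B(2) Z] .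
    \<comment> \<open>The point \<open>act t a\<close> shows that this open set is nonempty, so it
      can be shrunk to the next stage.\<close>
    have "open (Z \<inter> act (- t) -` B n)" "act t a \<in> Z \<inter> act (- t) -` B n"
      using t Z(1) B(1) open_act_vimage[OF flow] by (auto simp: act_minus[OF flow])
    then obtain Z' where "open Z'" "act t a \<in> Z'" "closure Z' \<subseteq> Z \<inter> act (- t) -` B n"
      using compact_t2_shrink[OF compact_UNIV] by metis
    then show ?thesis
      using t(2) unfolding Q_def by blast
  qed
  have "\<exists>Z :: nat \<Rightarrow> 'x set. \<forall>n. (open (Z n) \<and> Z n \<noteq> {}) \<and> (\<exists>t. Q n (Z n) (Z (Suc n)) t)"
  proof (rule dependent_nat_choice)
    show "\<exists>Z::'x set. open Z \<and> Z \<noteq> {}"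
      using open_UNIV by blast
  qed (use step in blast)
  then obtain Z t where Q: "\<And>n. Q n (Z n) (Z (Suc n)) (t n)"
    by metis
  have "decseq Z"
    using Q closure_subset unfolding decseq_Suc_iff Q_def by blast
  have ne: "filtermap t sequentially \<noteq> bot"
    by (simp add: filtermap_bot_iff)
  obtain z F where F: "F \<le> filtermap t sequentially" "F \<noteq> bot" "((\<lambda>t. act t x) \<longlongrightarrow> z) F"
    by (rule compact_subfilter_tendsto[OF compact_UNIV ne])
  have zZ: "z \<in> closure (Z n)" for n
  proof (rule Lim_in_closed_set[OF closed_closure _ F(2,3)])
    have "\<forall>\<^sub>F m in sequentially. act (t m) x \<in> closure (Z n)"
    proof (rule eventually_sequentiallyI)
      fix m assume "n \<le> m"
      then have "Z m \<subseteq> Z n"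
        using \<open>decseq Z\<close> by (simp add: decseq_def)
      then show "act (t m) x \<in> closure (Z n)"
        using Q[of m] closure_subset[of "Z n"] unfolding Q_def by blast
    qed
    then show "\<forall>\<^sub>F t in F. act t x \<in> closure (Z n)"
      by (intro filter_leD[OF F(1)]) (simp add: eventually_filtermap)
  qed
  show thesis
  proof
    show "F \<noteq> bot" "((\<lambda>t. act t x) \<longlongrightarrow> z) F"
      by fact+
    fix n
    have "\<forall>\<^sub>F m in sequentially. act (- t m) z \<in> B n"
    proof (rule eventually_sequentiallyI)
      fix m assume "n \<le> m"
      then have "B m \<subseteq> B n"
        using B(3) by (simp add: decseq_def)
      \<comment> \<open>The index \<open>Suc m\<close> matters: \<open>Q\<close> places the closure
        of \<open>Z (Suc m)\<close>, not that of \<open>Z m\<close>, in the preimage of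
        \<open>B m\<close>.\<close>
      then show "act (- t m) z \<in> B n"
        using Q[of m] zZ[of "Suc m"] unfolding Q_def by blast
    qed
    then show "\<forall>\<^sub>F t in F. act (- t) z \<in> B n"
      by (intro filter_leD[OF F(1)]) (simp add: eventually_filtermap)
  qed
qed

text \<open>Prescribing the same small neighbourhood \<open>V\<close> of \<open>y\<close> at every
  stage keeps the points \<open>act (- t) z\<close> in \<open>V\<close>; a cluster point of them
  belongs both to \<open>closure V\<close> and to the Veech set of \<open>x\<close>.\<close>

lemma pseudometric_rel_subset_closure_Veech:
  assumes xy: "(x, y) \<in> pseudometric_rel act"
  shows "y \<in> closure (Veech act `` {x})"
proof (rule ccontr)
  let ?C = "closure (Veech act `` {x})"
  assume "y \<notin> ?C"
  then have C: "y \<in> - ?C"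
    by simp
  obtain V where V: "open V" "y \<in> V" "closure V \<subseteq> - ?C"
    by (rule compact_t2_shrink[OF compact_UNIV open_Compl[OF closed_closure] C])
  have "decseq (\<lambda>_::nat. V)"
    by (simp add: decseq_def)
  then obtain F z where F: "F \<noteq> bot" "((\<lambda>t. act t x) \<longlongrightarrow> z) F"
    "\<forall>\<^sub>F t in F. act (- t) z \<in> V"
    using pseudometric_rel_return_filter[OF xy V(1,2)] by blast
  obtain w F' where F': "F' \<le> F" "F' \<noteq> bot" "((\<lambda>t. act (- t) z) \<longlongrightarrow> w) F'"
    by (rule compact_subfilter_tendsto[OF compact_UNIV F(1)])
  have "(x, w) \<in> Veech act"
    using F' filterlim_mono[OF F(2) order.refl F'(1)] unfolding Veech_def by blast
  moreover have "w \<in> closure V"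
  proof (rule Lim_in_closed_set[OF closed_closure _ F'(2,3)])
    show "\<forall>\<^sub>F t in F'. act (- t) z \<in> closure V"
      using filter_leD[OF F'(1) F(3)] by (rule eventually_mono) (use closure_subset in blast)
  qed
  ultimately show False
    using V(3) closure_subset[of "Veech act `` {x}"] by blast
qed

text \<open>With a countable base as the prescribed neighbourhoods, eventual membership in each
  \<open>B n\<close> is convergence to \<open>y\<close> itself.\<close>

lemma pseudometric_rel_subset_Veech:
  assumes "metrizable_space (euclidean :: 'x topology)"
  shows "pseudometric_rel act \<subseteq> Veech act"
proof clarify
  fix x y assume xy: "(x, y) \<in> pseudometric_rel act"
  obtain B :: "nat \<Rightarrow> 'x set" where B: "\<And>n. open (B n)" "\<And>n. y \<in> B n" "decseq B"
    and base: "\<And>U. open U \<Longrightarrow> y \<in> U \<Longrightarrow> \<exists>n. B n \<subseteq> U"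
    using metrizable_decreasing_nhds_base[OF assms] by metis
  obtain F z where F: "F \<noteq> bot" "((\<lambda>t. act t x) \<longlongrightarrow> z) F"
    and ev: "\<And>n. \<forall>\<^sub>F t in F. act (- t) z \<in> B n"
    using pseudometric_rel_return_filter[OF xy B] by metis
  have "((\<lambda>t. act (- t) z) \<longlongrightarrow> y) F"
  proof (rule topological_tendstoI)
    fix U assume "open U" "y \<in> U"
    then obtain n where "B n \<subseteq> U"
      using base by blast
    then show "\<forall>\<^sub>F t in F. act (- t) z \<in> U"
      using ev[of n] by (auto elim: eventually_mono)
  qed
  with F show "(x, y) \<in> Veech act"
    unfolding Veech_def by blast
qed

end

theorem mainTheorem7:
  fixes act :: "'t::topological_group_add \<Rightarrow> 'x::t2_space \<Rightarrow> 'x"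
  assumes "compact (UNIV :: 'x set)"
    and "is_flow act"
    and "minimal_flow act"
    and "has_invariant_prob act"
  shows "(\<forall>x. Veech act `` {x} \<subseteq> RP act `` {x} \<and> RP act `` {x} \<subseteq> closure (Veech act `` {x}))
    \<and> (metrizable_space (euclidean :: 'x topology) \<longrightarrow> Veech act = RP act \<and> Veech act = S_eq act)"
proof -
  obtain M :: "'x measure" where M: "prob_space M" "sets M = sets borel"
    "\<And>t A. A \<in> sets M \<Longrightarrow> emeasure M (act t -` A) = emeasure M A"
    using assms(4) unfolding has_invariant_prob_def by blast
  interpret measured_minimal_flow M act
    by (intro measured_minimal_flow.intro measured_minimal_flow_axioms.intro M assms(1-3))
  have V_RP: "Veech act \<subseteq> RP act"
    by (rule Veech_subset_RP[OF flow])
  have RP_R: "RP act \<subseteq> pseudometric_rel act"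
    by (rule RP_subset_pseudometric_rel)
  have "RP act `` {x} \<subseteq> closure (Veech act `` {x})" for x
    using RP_R pseudometric_rel_subset_closure_Veech by blast
  moreover have "Veech act = RP act \<and> Veech act = S_eq act"
    if "metrizable_space (euclidean :: 'x topology)"
  proof -
    \<comment> \<open>The inclusions close up: \<open>Veech act\<close>, \<open>RP act\<close>,
      \<open>S_eq act\<close>, \<open>pseudometric_rel act\<close> and again
      \<open>Veech act\<close>, each contained in the next.\<close>
    have "S_eq act \<subseteq> pseudometric_rel act"
      using admissible_pseudometric_rel[OF compact_UNIV, of act] unfolding S_eq_def by blast
    moreover have "RP act \<subseteq> S_eq act"
      using RP_subset_admissible_eq_rel[OF compact_UNIV flow] unfolding S_eq_def by blast
    ultimately show ?thesis
      using V_RP RP_R pseudometric_rel_subset_Veech[OF that] by blast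
  qed
  ultimately show ?thesis
    using V_RP by blast
qed

end
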